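(* Let $p,q\geq 3$ be integers. The graph $C_p\,\square\, C_q$ has the PMH--property if and only if $p=q=4$.
   Context: All graphs are finite, simple and connected. $C_n$ denotes the cycle on $n$ vertices. The Cartesian product $G\,\square\, H$ of graphs $G$ and $H$ has vertex set $V(G)\times V(H)$, where $(u,v)$ and $(u',v')$ are adjacent if and only if either $u=u'$ and $vv'\in E(H)$, or $uu'\in E(G)$ and $v=v'$. A perfect matching $M$ of a graph $G$ can be extended to a Hamiltonian cycle if there exists a perfect matching $N$ of $G$ such that $M\cup N$ is (the edge set of) a Hamiltonian cycle of $G$. A graph has the PMH--property (Perfect--Matching--Hamiltonian property) if it admits at least one perfect matching and every perfect matching of it can be extended to a Hamiltonian cycle; in particular, a graph with no perfect matching does not have the PMH--property. *)

theory Defs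
  imports Main
begin

text \<open>A (finite simple) graph is a pair (V, E) of a vertex set and a set of
  2-element edges, each edge being a subset of V.\<close>
type_synonym 'a graph = "'a set \<times> 'a set set"

definition verts :: "'a graph \<Rightarrow> 'a set" where "verts G = fst G"
definition edges :: "'a graph \<Rightarrow> 'a set set" where "edges G = snd G"

text \<open>The cycle C_n on vertices 0..n-1 (intended for n >= 3).\<close>
definition cycle_graph :: "nat \<Rightarrow> nat graph" where
  "cycle_graph n = ({..<n}, {{i, (i + 1) mod n} | i. i < n})"

definition cart_prod :: "'a graph \<Rightarrow> 'b graph \<Rightarrow> ('a \<times> 'b) graph" where
  "cart_prod G H =
     (verts G \<times> verts H,
      {{(u, v), (u, v')} | u v v'. u \<in> verts G \<and> {v, v'} \<in> edges H \<and> v \<noteq> v'}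
      \<union> {{(u, v), (u', v)} | u u' v. {u, u'} \<in> edges G \<and> u \<noteq> u' \<and> v \<in> verts H})"

definition perfect_matching :: "'a graph \<Rightarrow> 'a set set \<Rightarrow> bool" where
  "perfect_matching G M \<longleftrightarrow> M \<subseteq> edges G \<and> (\<forall>v \<in> verts G. \<exists>!e. e \<in> M \<and> v \<in> e)"

definition hamiltonian_cycle :: "'a graph \<Rightarrow> 'a set set \<Rightarrow> bool" where
  "hamiltonian_cycle G H \<longleftrightarrow> H \<subseteq> edges G \<and>
     (\<exists>vs. distinct vs \<and> set vs = verts G \<and> length vs \<ge> 3 \<and>
        H = {{vs ! i, vs ! (Suc i mod length vs)} | i. i < length vs})"

definition PMH_property :: "'a graph \<Rightarrow> bool" where
  "PMH_property G \<longleftrightarrow> (\<exists>M. perfect_matching G M) \<and>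
     (\<forall>M. perfect_matching G M \<longrightarrow>
        (\<exists>N. perfect_matching G N \<and> hamiltonian_cycle G (M \<union> N)))"

end

theory Submission
  imports Defs
begin

text \<open>
  If \<open>p\<close> and \<open>q\<close> are odd there is no perfect matching, so by symmetry let \<open>p\<close> be even. Match every row of
  a band of consecutive rows horizontally, shifting the pattern by one from each row to the next. For any
  further perfect matching \<open>N\<close>, the part of \<open>M \<union> N\<close> inside the band consists of disjoint strands that all
  run round the torus in the same direction. Hence strands keep their vertical order, and the number of strands
  below (or above) a given one only changes when strands enter or leave through the boundary of the band.

  If \<open>q\<close> is odd, the band is the whole torus cut along a seam between two rows of equal shift. An edge
  of \<open>N\<close> across the seam joins the ends of the lowest and the highest strand, so the absolute value of
  (strands below) - (strands above) is constant on a Hamiltonian cycle, which is impossible.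
  If \<open>q \<ge> 6\<close> is even, the band has \<open>q - 2\<close> rows and the two other rows are matched vertically with each
  other; then only an outermost strand can leave the band, and a strand in the middle closes up on itself.
  The graph \<open>C\<^sub>4 \<times> C\<^sub>4\<close> is settled by a search verified by rewriting.
\<close>

section \<open>Perfect matchings and Hamiltonian cycles\<close>

text \<open>Consecutive entries of the vertex list are joined by edges of \<open>H\<close>, so an
  edge invariant propagates along the list. Every later refutation exhibits such an invariant that
  takes two values.\<close>

lemma hamiltonian_cycle_const:
  assumes "hamiltonian_cycle G H"
    and inv: "\<And>x y. {x, y} \<in> H \<Longrightarrow> f x = f y"
    and "x \<in> verts G" "y \<in> verts G"
  shows "f x = f y"
proof -
  obtain vs where vs: "set vs = verts G"
    and H: "H = {{vs ! i, vs ! (Suc i mod length vs)} | i. i < length vs}"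
    using assms(1) by (auto simp: hamiltonian_cycle_def)
  have "f (vs ! i) = f (vs ! 0)" if "i < length vs" for i
    using that
  proof (induction i)
    case (Suc i)
    then have "{vs ! i, vs ! Suc i} \<in> H"
      unfolding H by (intro CollectI exI[of _ i]) auto
    then show ?case using inv Suc by fastforce
  qed simp
  then show ?thesis
    using assms(3,4) unfolding vs[symmetric] by (metis in_set_conv_nth)
qed

text \<open>A common edge is the only edge of \<open>M \<union> N\<close> at either of its ends, so
  membership in it is an edge invariant. It would contain all vertices, of which a cycle has at
  least three.\<close>

lemma hamiltonian_union_disjoint:
  assumes H: "hamiltonian_cycle G (M \<union> N)"
    and M: "perfect_matching G M" and N: "perfect_matching G N"
    and E: "\<And>e. e \<in> edges G \<Longrightarrow> card e = 2 \<and> e \<subseteq> verts G"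
  shows "M \<inter> N = {}"
proof (rule ccontr)
  assume "M \<inter> N \<noteq> {}"
  then obtain e where e: "e \<in> M" "e \<in> N" by auto
  have uniq: "e' = e" if "e' \<in> M \<union> N" "x \<in> e'" "x \<in> e" for x e'
  proof -
    have "x \<in> verts G" using E e M that by (auto simp: perfect_matching_def)
    then have "\<exists>!e. e \<in> M \<and> x \<in> e" "\<exists>!e. e \<in> N \<and> x \<in> e"
      using M N unfolding perfect_matching_def by blast+
    then show ?thesis using that e by blast
  qed
  have inv: "(x \<in> e) = (y \<in> e)" if "{x, y} \<in> M \<union> N" for x y
    using uniq[OF that] by auto
  have ee: "card e = 2" "e \<subseteq> verts G" using E e M by (auto simp: perfect_matching_def)
  obtain vs where vs: "distinct vs" "set vs = verts G" "length vs \<ge> 3"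
    using H by (auto simp: hamiltonian_cycle_def)
  have c3: "card (verts G) \<ge> 3" using vs by (metis distinct_card)
  have "e \<noteq> {}" using ee by auto
  then obtain a where a: "a \<in> e" by auto
  have "verts G \<subseteq> e"
  proof
    fix y assume "y \<in> verts G"
    then show "y \<in> e"
      using hamiltonian_cycle_const[OF H, where f = "\<lambda>x. x \<in> e" and x = a and y = y] inv a ee by auto
  qed
  then have "e = verts G" using ee by auto
  then show False using c3 ee by simp
qed

section \<open>Transport along injective vertex maps\<close>

definition map_graph :: "('a \<Rightarrow> 'b) \<Rightarrow> 'a graph \<Rightarrow> 'b graph" where
  "map_graph f G = (f ` verts G, image f ` edges G)"

lemma map_graph_simps [simp]:
  "verts (map_graph f G) = f ` verts G" "edges (map_graph f G) = image f ` edges G"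
  by (simp_all add: map_graph_def verts_def edges_def)

lemma perfect_matching_map:
  assumes "inj f"
  shows "perfect_matching (map_graph f G) (image f ` M) \<longleftrightarrow> perfect_matching G M"
proof -
  have *: "(\<exists>!e. e \<in> image f ` M \<and> f v \<in> e) \<longleftrightarrow> (\<exists>!e. e \<in> M \<and> v \<in> e)" for v
  proof
    assume "\<exists>!e. e \<in> M \<and> v \<in> e"
    then obtain e where e: "e \<in> M" "v \<in> e" and u: "\<And>e'. e' \<in> M \<Longrightarrow> v \<in> e' \<Longrightarrow> e' = e" by metis
    show "\<exists>!e. e \<in> image f ` M \<and> f v \<in> e"
    proof (rule ex1I[of _ "f ` e"])
      fix e' assume "e' \<in> image f ` M \<and> f v \<in> e'"
      then obtain x where "x \<in> M" "e' = f ` x" "f v \<in> f ` x" by blast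
      then show "e' = f ` e" using u[of x] by (simp add: inj_image_mem_iff[OF assms])
    qed (use e in simp)
  next
    assume "\<exists>!e. e \<in> image f ` M \<and> f v \<in> e"
    then obtain d where d: "d \<in> image f ` M \<and> f v \<in> d"
      and ud: "\<forall>e'. e' \<in> image f ` M \<and> f v \<in> e' \<longrightarrow> e' = d" by (rule ex1E)
    from d obtain e where e: "e \<in> M" "f v \<in> f ` e" and de: "d = f ` e" by blast
    have u: "f ` e' = f ` e" if "e' \<in> M" "f v \<in> f ` e'" for e'
      using ud[rule_format, of "f ` e'"] that de by simp
    show "\<exists>!e. e \<in> M \<and> v \<in> e"
    proof (rule ex1I[of _ e])
      show "e \<in> M \<and> v \<in> e" using e by (simp add: inj_image_mem_iff[OF assms])
      fix e' assume "e' \<in> M \<and> v \<in> e'"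
      then have "f ` e' = f ` e" using u by simp
      then show "e' = e" by (simp add: inj_image_eq_iff[OF assms])
    qed
  qed
  have "inj (image f)" by (rule injI) (simp add: inj_image_eq_iff[OF assms])
  then have "image f ` M \<subseteq> image f ` edges G \<longleftrightarrow> M \<subseteq> edges G"
    by (rule inj_image_subset_iff)
  then show ?thesis by (simp add: perfect_matching_def *)
qed

lemma hamiltonian_cycle_map:
  assumes "inj f" "hamiltonian_cycle G H"
  shows "hamiltonian_cycle (map_graph f G) (image f ` H)"
proof -
  obtain vs where vs: "distinct vs" "set vs = verts G" "length vs \<ge> 3"
    "H = {{vs ! i, vs ! (Suc i mod length vs)} | i. i < length vs}" and "H \<subseteq> edges G"
    using assms(2) by (auto simp: hamiltonian_cycle_def)
  have lt: "Suc i mod length vs < length vs" for i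
    using vs(3) by (intro mod_less_divisor) linarith
  have "image f ` H = (\<lambda>i. f ` {vs ! i, vs ! (Suc i mod length vs)}) ` {..<length vs}"
    unfolding vs(4) by (simp add: setcompr_eq_image image_image lessThan_def)
  also have "\<dots> = (\<lambda>i. {map f vs ! i, map f vs ! (Suc i mod length (map f vs))}) ` {..<length (map f vs)}"
    using lt by (intro image_cong) auto
  finally have "image f ` H = {{map f vs ! i, map f vs ! (Suc i mod length (map f vs))} | i. i < length (map f vs)}"
    by (simp only: setcompr_eq_image lessThan_def)
  moreover have "distinct (map f vs)" using assms(1) vs(1) by (simp add: distinct_map inj_on_subset[OF assms(1)])
  moreover have "image f ` H \<subseteq> edges (map_graph f G)"
    using \<open>H \<subseteq> edges G\<close> by (simp add: image_mono)
  moreover have "set (map f vs) = verts (map_graph f G)" "length (map f vs) \<ge> 3"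
    using vs by simp_all
  ultimately show ?thesis
    unfolding hamiltonian_cycle_def by blast
qed

text \<open>Every perfect matching of the image graph is the image of one of \<open>G\<close>, where
  the extension is found and mapped forward.\<close>

lemma PMH_property_map:
  assumes f: "inj f" and G: "PMH_property G"
  shows "PMH_property (map_graph f G)"
  unfolding PMH_property_def
proof (intro conjI allI impI)
  show "\<exists>M. perfect_matching (map_graph f G) M"
    using G perfect_matching_map[OF f] unfolding PMH_property_def by blast
next
  fix M' assume M': "perfect_matching (map_graph f G) M'"
  then have "M' \<subseteq> image f ` edges G" by (simp add: perfect_matching_def)
  then obtain M where M: "M' = image f ` M" by (meson subset_imageE)
  then have "perfect_matching G M" using M' perfect_matching_map[OF f] by blast
  then obtain N where N: "perfect_matching G N" "hamiltonian_cycle G (M \<union> N)"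
    using G unfolding PMH_property_def by blast
  then show "\<exists>N. perfect_matching (map_graph f G) N \<and> hamiltonian_cycle (map_graph f G) (M' \<union> N)"
    using perfect_matching_map[OF f] hamiltonian_cycle_map[OF f N(2)] unfolding M image_Un by blast
qed

lemma map_graph_swap: "map_graph prod.swap (cart_prod G H) = cart_prod H G"
proof -
  have "image prod.swap ` edges (cart_prod G H) = edges (cart_prod H G)"
  proof -
    have "image prod.swap ` {{(u, v), (u, v')} | u v v'. u \<in> verts G \<and> {v, v'} \<in> edges H \<and> v \<noteq> v'}
      = {{(v, u), (v', u)} | v v' u. {v, v'} \<in> edges H \<and> v \<noteq> v' \<and> u \<in> verts G}" (is "_ ` ?A = ?B")
    proof (intro set_eqI iffI)
      fix e assume "e \<in> ?B"
      then obtain u v v' where "e = {(v, u), (v', u)}" "{v, v'} \<in> edges H \<and> v \<noteq> v' \<and> u \<in> verts G" by blast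
      then show "e \<in> image prod.swap ` ?A" by (intro image_eqI[of _ _ "{(u, v), (u, v')}"]) auto
    qed fastforce
    moreover have "image prod.swap ` {{(u, v), (u', v)} | u u' v. {u, u'} \<in> edges G \<and> u \<noteq> u' \<and> v \<in> verts H}
      = {{(v, u), (v, u')} | v u u'. v \<in> verts H \<and> {u, u'} \<in> edges G \<and> u \<noteq> u'}" (is "_ ` ?A = ?B")
    proof (intro set_eqI iffI)
      fix e assume "e \<in> ?B"
      then obtain u u' v where "e = {(v, u), (v, u')}" "v \<in> verts H \<and> {u, u'} \<in> edges G \<and> u \<noteq> u'" by blast
      then show "e \<in> image prod.swap ` ?A" by (intro image_eqI[of _ _ "{(u, v), (u', v)}"]) auto
    qed fastforce
    ultimately show ?thesis by (simp add: cart_prod_def edges_def[of "(_, _)"] image_Un Un_commute)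
  qed
  then show ?thesis
    by (simp add: map_graph_def cart_prod_def verts_def edges_def product_swap)
qed

text \<open>Lets the negative results assume that the even length is that of the first
  factor.\<close>

lemma PMH_property_swap: "PMH_property (cart_prod G H) \<Longrightarrow> PMH_property (cart_prod H G)"
  using PMH_property_map[of prod.swap "cart_prod G H"] by (simp add: map_graph_swap)

section \<open>The torus\<close>

text \<open>Integer coordinates modulo \<open>p\<close> and \<open>q\<close>: predecessors and
  wrapping around need no case distinction, unlike on \<open>nat\<close>.\<close>

definition vert :: "nat \<Rightarrow> nat \<Rightarrow> int \<Rightarrow> int \<Rightarrow> nat \<times> nat" where
  "vert p q i j = (nat (i mod int p), nat (j mod int q))"

locale torus =
  fixes p q :: nat
  assumes p3: "p \<ge> 3" and q3: "q \<ge> 3"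
begin

abbreviation "T \<equiv> cart_prod (cycle_graph p) (cycle_graph q)"
abbreviation "v \<equiv> vert p q"
definition hedge :: "int \<Rightarrow> int \<Rightarrow> (nat \<times> nat) set" where
  "hedge i j = {v i j, v (i + 1) j}"
definition vedge :: "int \<Rightarrow> int \<Rightarrow> (nat \<times> nat) set" where
  "vedge i j = {v i j, v i (j + 1)}"

lemma v_eq: "v i j = v a b \<longleftrightarrow> i mod int p = a mod int p \<and> j mod int q = b mod int q"
  using p3 q3 by (auto simp: vert_def nat_eq_iff)

lemma verts_T: "verts T = range (\<lambda>(i, j). v i j)"
proof -
  have "x \<in> range (\<lambda>(i, j). v i j)" if "x \<in> {..<p} \<times> {..<q}" for x
  proof (rule image_eqI[of _ _ "(int (fst x), int (snd x))"])
    show "x = (case (int (fst x), int (snd x)) of (i, j) \<Rightarrow> v i j)"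
      using that by (auto simp: vert_def simp flip: of_nat_mod)
  qed simp
  then show ?thesis using p3 q3
    by (auto simp: cart_prod_def cycle_graph_def verts_def vert_def nat_less_iff)
qed

lemma v_in_verts [simp]: "v i j \<in> verts T"
  unfolding verts_T by auto

lemma add_mod_eq: "(i + d) mod int n = i mod int n \<longleftrightarrow> int n dvd d" for i d :: int
  by (metis add_diff_cancel_left' mod_eq_dvd_iff)

lemma cycle_edge_iff:
  assumes "n \<ge> 3"
  shows "{a, b} \<in> edges (cycle_graph n) \<and> a \<noteq> b \<longleftrightarrow>
    (\<exists>i::int. {a, b} = {nat (i mod int n), nat ((i + 1) mod int n)})"
    (is "?L \<longleftrightarrow> ?R")
proof
  assume ?L
  then obtain i where "i < n" "{a, b} = {i, (i + 1) mod n}"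
    by (auto simp: edges_def cycle_graph_def)
  then have "{a, b} = {nat (int i mod int n), nat ((int i + 1) mod int n)}"
    by (metis mod_less nat_int of_nat_Suc of_nat_mod Suc_eq_plus1 add.commute)
  then show ?R by blast
next
  assume ?R
  then obtain i :: int where i: "{a, b} = {nat (i mod int n), nat ((i + 1) mod int n)}" by blast
  define k where "k = nat (i mod int n)"
  have k: "int k = i mod int n" "k < n" using assms by (auto simp: k_def nat_less_iff)
  have *: "nat ((i + 1) mod int n) = (k + 1) mod n"
    using k by (metis mod_add_left_eq nat_int of_nat_Suc of_nat_mod Suc_eq_plus1 add.commute)
  have "k \<noteq> (k + 1) mod n" using k(2) assms by (cases "k + 1 = n") auto
  then show ?L using i k * unfolding k_def[symmetric] *
    by (auto simp: edges_def cycle_graph_def doubleton_eq_iff)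
qed

lemma edges_T: "edges T = range (\<lambda>(i, j). hedge i j) \<union> range (\<lambda>(i, j). vedge i j)"
proof -
  have V: "verts (cycle_graph n) = range (\<lambda>i. nat (i mod int n))" if "n \<ge> 3" for n
  proof -
    have "x \<in> range (\<lambda>i. nat (i mod int n))" if "x < n" for x
      using that by (intro image_eqI[of _ _ "int x"]) auto
    then show ?thesis using that by (auto simp: cycle_graph_def verts_def nat_less_iff)
  qed
  have D: "{(u, w), (u, w')} = {(u, a), (u, b)} \<longleftrightarrow> {w, w'} = {a, b}"
    "{(w, u), (w', u)} = {(a, u), (b, u)} \<longleftrightarrow> {w, w'} = {a, b}" for u w w' a b :: nat
    by (auto simp: doubleton_eq_iff)
  have "{{(u, w), (u, w')} | u w w'. u \<in> verts (cycle_graph p) \<and> {w, w'} \<in> edges (cycle_graph q) \<and> w \<noteq> w'}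
      = range (\<lambda>(i, j). vedge i j)" (is "?A = ?B")
  proof (intro set_eqI iffI)
    fix e assume "e \<in> ?A"
    then obtain u w w' where e: "e = {(u, w), (u, w')}" "u \<in> verts (cycle_graph p)"
      "{w, w'} \<in> edges (cycle_graph q) \<and> w \<noteq> w'" by auto
    then obtain i j where "u = nat (i mod int p)" "{w, w'} = {nat (j mod int q), nat ((j + 1) mod int q)}"
      unfolding V[OF p3] cycle_edge_iff[OF q3] by auto
    then have "e = vedge i j" unfolding e vedge_def vert_def by (simp add: D)
    then show "e \<in> ?B" by auto
  next
    fix e assume "e \<in> ?B"
    then obtain i j where e: "e = vedge i j" by auto
    let ?w = "nat (j mod int q)" and ?w' = "nat ((j + 1) mod int q)"
    have "{?w, ?w'} \<in> edges (cycle_graph q) \<and> ?w \<noteq> ?w'"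
      unfolding cycle_edge_iff[OF q3] by auto
    moreover have "nat (i mod int p) \<in> verts (cycle_graph p)" unfolding V[OF p3] by auto
    ultimately show "e \<in> ?A" unfolding e vedge_def vert_def by blast
  qed
  moreover have "{{(u, w), (u', w)} | u u' w. {u, u'} \<in> edges (cycle_graph p) \<and> u \<noteq> u' \<and> w \<in> verts (cycle_graph q)}
      = range (\<lambda>(i, j). hedge i j)" (is "?A = ?B")
  proof (intro set_eqI iffI)
    fix e assume "e \<in> ?A"
    then obtain u u' w where e: "e = {(u, w), (u', w)}" "w \<in> verts (cycle_graph q)"
      "{u, u'} \<in> edges (cycle_graph p) \<and> u \<noteq> u'" by auto
    then obtain i j where "w = nat (j mod int q)" "{u, u'} = {nat (i mod int p), nat ((i + 1) mod int p)}"
      unfolding V[OF q3] cycle_edge_iff[OF p3] by auto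
    then have "e = hedge i j" unfolding e hedge_def vert_def by (simp add: D)
    then show "e \<in> ?B" by auto
  next
    fix e assume "e \<in> ?B"
    then obtain i j where e: "e = hedge i j" by auto
    let ?w = "nat (i mod int p)" and ?w' = "nat ((i + 1) mod int p)"
    have "{?w, ?w'} \<in> edges (cycle_graph p) \<and> ?w \<noteq> ?w'"
      unfolding cycle_edge_iff[OF p3] by auto
    moreover have "nat (j mod int q) \<in> verts (cycle_graph q)" unfolding V[OF q3] by auto
    ultimately show "e \<in> ?A" unfolding e hedge_def vert_def by blast
  qed
  ultimately show ?thesis by (auto simp: cart_prod_def edges_def)
qed

text \<open>A number that is at least 3 divides neither 1 nor 2. Offset 1 separates the ends of an
  edge; offset 2 prevents neighbouring indices from describing one edge with its ends
  exchanged.\<close>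

lemma nz: "(i + 1) mod int p \<noteq> i mod int p" "(j + 1) mod int q \<noteq> j mod int q"
  "(i + 2) mod int p \<noteq> i mod int p" "(j + 2) mod int q \<noteq> j mod int q" for i j :: int
  using p3 q3 by (auto simp: add_mod_eq dest!: zdvd_imp_le)

lemma mod_shift: "(i + 1) mod int n = (a + 1) mod int n \<longleftrightarrow> i mod int n = a mod int n" for i a :: int
  by (metis add_diff_cancel_right mod_eq_dvd_iff)

lemma hedge_eq: "hedge i j = hedge a b \<longleftrightarrow> i mod int p = a mod int p \<and> j mod int q = b mod int q"
proof -
  have "\<not> (i mod int p = (a + 1) mod int p \<and> (i + 1) mod int p = a mod int p)"
  proof
    assume "i mod int p = (a + 1) mod int p \<and> (i + 1) mod int p = a mod int p"
    then have "(a + 1 + 1) mod int p = a mod int p" by (metis mod_add_left_eq)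
    then show False using nz(3)[of a] by (simp add: add.assoc)
  qed
  then show ?thesis
    unfolding hedge_def doubleton_eq_iff v_eq by (auto simp: mod_shift)
qed

lemma vedge_eq: "vedge i j = vedge a b \<longleftrightarrow> i mod int p = a mod int p \<and> j mod int q = b mod int q"
proof -
  have "\<not> (j mod int q = (b + 1) mod int q \<and> (j + 1) mod int q = b mod int q)"
  proof
    assume "j mod int q = (b + 1) mod int q \<and> (j + 1) mod int q = b mod int q"
    then have "(b + 1 + 1) mod int q = b mod int q" by (metis mod_add_left_eq)
    then show False using nz(4)[of b] by (simp add: add.assoc)
  qed
  then show ?thesis
    unfolding vedge_def doubleton_eq_iff v_eq by (auto simp: mod_shift)
qed

lemma hedge_neq_vedge: "hedge i j \<noteq> vedge a b" "vedge a b \<noteq> hedge i j"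
proof -
  show "hedge i j \<noteq> vedge a b"
    unfolding hedge_def vedge_def doubleton_eq_iff v_eq using nz(1)[of i] by auto
  then show "vedge a b \<noteq> hedge i j" by metis
qed

lemma hedge_wrap: "hedge (i + int p) j = hedge i j" "hedge i (j + int q) = hedge i j"
  by (simp_all add: hedge_eq)

lemma vedge_wrap: "vedge (i + int p) j = vedge i j" "vedge i (j + int q) = vedge i j"
  by (simp_all add: vedge_eq)

lemma incident_edges:
  "{e \<in> edges T. v i j \<in> e} = {hedge i j, hedge (i - 1) j, vedge i j, vedge i (j - 1)}"
proof (intro set_eqI iffI)
  fix e assume "e \<in> {e \<in> edges T. v i j \<in> e}"
  then have "v i j \<in> e" "(\<exists>a b. e = hedge a b) \<or> (\<exists>a b. e = vedge a b)"
    by (auto simp: edges_T)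
  then show "e \<in> {hedge i j, hedge (i - 1) j, vedge i j, vedge i (j - 1)}"
  proof (elim disjE exE)
    fix a b assume e: "v i j \<in> e" "e = hedge a b"
    then have "v i j = v a b \<or> v i j = v (a + 1) b" by (simp add: hedge_def)
    then have "hedge a b = hedge i j \<or> hedge a b = hedge (i - 1) j"
      using mod_shift[of "i - 1" p a] unfolding v_eq hedge_eq by fastforce
    then show ?thesis using e by blast
  next
    fix a b assume e: "v i j \<in> e" "e = vedge a b"
    then have "v i j = v a b \<or> v i j = v a (b + 1)" by (simp add: vedge_def)
    then have "vedge a b = vedge i j \<or> vedge a b = vedge i (j - 1)"
      using mod_shift[of "j - 1" q b] unfolding v_eq vedge_eq by fastforce
    then show ?thesis using e by blast
  qed
next
  fix e assume "e \<in> {hedge i j, hedge (i - 1) j, vedge i j, vedge i (j - 1)}"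
  moreover have "v i j \<in> hedge i j" "v i j \<in> hedge (i - 1) j" "v i j \<in> vedge i j" "v i j \<in> vedge i (j - 1)"
    by (auto simp: hedge_def vedge_def)
  ultimately show "e \<in> {e \<in> edges T. v i j \<in> e}" by (auto simp: edges_T)
qed

text \<open>The four edges at a vertex are pairwise distinct, so unique existence becomes an
  equation between integers.\<close>

lemma perfect_matching_iff:
  "perfect_matching T M \<longleftrightarrow> M \<subseteq> edges T \<and>
    (\<forall>i j. of_bool (hedge i j \<in> M) + of_bool (hedge (i - 1) j \<in> M)
         + of_bool (vedge i j \<in> M) + of_bool (vedge i (j - 1) \<in> M) = (1::int))"
proof -
  have "(\<exists>!e. e \<in> M \<and> v i j \<in> e) \<longleftrightarrow>
    of_bool (hedge i j \<in> M) + of_bool (hedge (i - 1) j \<in> M)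
         + of_bool (vedge i j \<in> M) + of_bool (vedge i (j - 1) \<in> M) = (1::int)"
    if "M \<subseteq> edges T" for i j
  proof -
    have "e \<in> M \<and> v i j \<in> e \<longleftrightarrow> e \<in> M \<and> e \<in> {hedge i j, hedge (i - 1) j, vedge i j, vedge i (j - 1)}" for e
      using that incident_edges[of i j] by blast
    moreover have "hedge i j \<noteq> hedge (i - 1) j" "vedge i j \<noteq> vedge i (j - 1)"
      using nz(1)[of "i - 1"] nz(2)[of "j - 1"] by (auto simp: hedge_eq vedge_eq)
    moreover have "(\<exists>!e. e \<in> M \<and> e \<in> {a, b, c, d}) \<longleftrightarrow>
        of_bool (a \<in> M) + of_bool (b \<in> M) + of_bool (c \<in> M) + of_bool (d \<in> M) = (1::int)"
      if "a \<noteq> b" "c \<noteq> d" "a \<noteq> c" "a \<noteq> d" "b \<noteq> c" "b \<noteq> d" for a b c d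
      using that
      by (cases "a \<in> M"; cases "b \<in> M"; cases "c \<in> M"; cases "d \<in> M") (simp_all, blast+)
    ultimately show ?thesis
      using hedge_neq_vedge by (simp only: not_False_eq_True)
  qed
  note key = this
  have "perfect_matching T M \<longleftrightarrow> M \<subseteq> edges T \<and> (\<forall>i j. \<exists>!e. e \<in> M \<and> v i j \<in> e)"
    unfolding perfect_matching_def verts_T by (simp add: split_paired_All)
  then show ?thesis using key by (simp only: key cong: conj_cong)
qed

text \<open>The edge conditions concern only rows \<open>0\<close> to \<open>q - 1\<close>: labels
  are indexed by natural row numbers, and the step from row \<open>q - 1\<close> to row
  \<open>0\<close> needs its own argument. Columns stay unrestricted.\<close>

lemma hamiltonian_const:
  assumes "hamiltonian_cycle T H"
    and per: "\<And>i j. f (i + int p) j = f i j" "\<And>i j. f i (j + int q) = f i j"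
    and h: "\<And>i j. 0 \<le> j \<Longrightarrow> j < int q \<Longrightarrow> hedge i j \<in> H \<Longrightarrow> f i j = f (i + 1) j"
    and w: "\<And>i j. 0 \<le> j \<Longrightarrow> j < int q \<Longrightarrow> vedge i j \<in> H \<Longrightarrow> f i j = f i (j + 1)"
  shows "f i j = f a b"
proof -
  have P1: "f (i + int p * k) j = f i j" for i j k
  proof (induction k rule: int_induct[where k = 0])
    case (step1 k)
    show ?case using per(1)[of "i + int p * k" j] step1 by (simp add: algebra_simps)
  next
    case (step2 k)
    show ?case using per(1)[of "i + int p * (k - 1)" j] step2 by (simp add: algebra_simps)
  qed simp
  have P2: "f i (j + int q * k) = f i j" for i j k
  proof (induction k rule: int_induct[where k = 0])
    case (step1 k)
    show ?case using per(2)[of i "j + int q * k"] step1 by (simp add: algebra_simps)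
  next
    case (step2 k)
    show ?case using per(2)[of i "j + int q * (k - 1)"] step2 by (simp add: algebra_simps)
  qed simp
  have m1: "f (i mod int p) j = f i j" for i j
    using P1[of "i mod int p" "i div int p" j] by (simp add: mod_mult_div_eq)
  have m2: "f i (j mod int q) = f i j" for i j
    using P2[of i "j mod int q" "j div int q"] by (simp add: mod_mult_div_eq)
  \<comment> \<open>Reads \<open>f\<close> at standard representatives; periodicity extends this to
    all coordinates.\<close>
  define g where "g = (\<lambda>x. f (int (fst x)) (int (snd x)))"
  have g: "g (v i j) = f i j" for i j
    using p3 q3 by (simp add: g_def vert_def m1 m2)
  have hh: "f i j = f (i + 1) j" if "hedge i j \<in> H" for i j
  proof -
    have "hedge i j = hedge i (j mod int q)" by (simp add: hedge_eq)
    then show ?thesis using h[of "j mod int q" i] that q3 by (simp add: m2)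
  qed
  have ww: "f i j = f i (j + 1)" if "vedge i j \<in> H" for i j
  proof -
    have "vedge i j = vedge i (j mod int q)" by (simp add: vedge_eq)
    then have "f i j = f i (j mod int q + 1)" using w[of "j mod int q" i] that q3 by (simp add: m2)
    also have "\<dots> = f i (j + 1)" using m2[of i "j mod int q + 1"] m2[of i "j + 1"] by (simp add: mod_add_left_eq)
    finally show ?thesis .
  qed
  have "g x = g y" if xy: "{x, y} \<in> H" for x y
  proof -
    have "{x, y} \<in> edges T" using assms(1) xy by (auto simp: hamiltonian_cycle_def)
    then consider a b where "{x, y} = hedge a b" | a b where "{x, y} = vedge a b"
      by (auto simp: edges_T)
    then show ?thesis
    proof cases
      case 1
      then have "f a b = f (a + 1) b" using hh xy by metis
      then show ?thesis using 1 by (auto simp: hedge_def doubleton_eq_iff g)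
    next
      case 2
      then have "f a b = f a (b + 1)" using ww xy by metis
      then show ?thesis using 2 by (auto simp: vedge_def doubleton_eq_iff g)
    qed
  qed
  then have "g (v i j) = g (v a b)"
    by (rule hamiltonian_cycle_const[OF assms(1), where f = g, OF _ v_in_verts v_in_verts])
  then show ?thesis by (simp add: g)
qed

lemma edge_T: "e \<in> edges T \<Longrightarrow> card e = 2 \<and> e \<subseteq> verts T"
  by (auto simp: edges_T hedge_def vedge_def v_eq card_insert_if nz(1,2)[THEN not_sym])

end

section \<open>Strands\<close>

text \<open>
  \<open>h i j\<close> says that \<open>M \<union> N\<close> contains the horizontal edge from column \<open>i\<close> to \<open>i + 1\<close> in row \<open>j\<close>, and \<open>u i j\<close>
  that \<open>N\<close> contains the vertical edge in column \<open>i\<close> from row \<open>j - 1\<close> to \<open>j\<close>; rows are \<open>0, \<dots>, n - 1\<close>, so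
  \<open>u i 0\<close> and \<open>u i n\<close> cross the boundary.
\<close>

definition alt :: "int \<Rightarrow> int" where "alt i = (if even i then 1 else - 1)"

locale strands =
  fixes n :: nat and h u :: "int \<Rightarrow> nat \<Rightarrow> bool"
  assumes even_row: "\<And>i j. j < n \<Longrightarrow> even (i + int j) \<Longrightarrow> h i j \<and> (h (i - 1) j \<longleftrightarrow> \<not> u i j \<and> \<not> u i (Suc j))"
    and odd_row: "\<And>i j. j < n \<Longrightarrow> odd (i + int j) \<Longrightarrow> h (i - 1) j \<and> (h i j \<longleftrightarrow> \<not> u i j \<and> \<not> u i (Suc j))"
    and not_both: "\<And>i j. j < n \<Longrightarrow> \<not> (u i j \<and> u i (Suc j))"
begin

text \<open>The number of strands that pass below row \<open>j\<close> through the gap between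
  columns \<open>i\<close> and \<open>i + 1\<close>.\<close>

definition rank :: "int \<Rightarrow> nat \<Rightarrow> int" where
  "rank i j = (\<Sum>k<j. of_bool (h i k))"

lemma rank_0 [simp]: "rank i 0 = 0"
  and rank_Suc: "rank i (Suc j) = rank i j + of_bool (h i j)"
  by (simp_all add: rank_def)

lemma rank_mono: "j \<le> k \<Longrightarrow> rank i j \<le> rank i k"
  unfolding rank_def by (intro sum_mono2) auto

text \<open>The edge of \<open>M\<close> at a band vertex is always present, and the opposite
  horizontal edge is present unless a vertical one replaces it.\<close>

lemma h_diff:
  assumes "j < n"
  shows "of_bool (h i j) - of_bool (h (i - 1) j) = alt (i + int j) * (of_bool (u i j) + of_bool (u i (Suc j)))"
  using even_row[OF assms, of i] odd_row[OF assms, of i] not_both[OF assms, of i]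
  by (cases "even (i + int j)") (auto simp: alt_def)

text \<open>When \<open>h_diff\<close> is summed over the rows below \<open>j\<close>, an inner
  vertical edge is counted at both ends with opposite signs. Only the edges entering at rows
  \<open>0\<close> and \<open>j\<close> remain.\<close>

lemma rank_diff:
  "j \<le> n \<Longrightarrow> rank i j - rank (i - 1) j = alt i * of_bool (u i 0) - alt (i + int j) * of_bool (u i j)"
proof (induction j)
  case (Suc j)
  moreover have "alt (i + int (Suc j)) = - alt (i + int j)" by (simp add: alt_def)
  ultimately show ?case
    using h_diff[of j i] by (simp add: rank_Suc algebra_simps)
qed simp

end

text \<open>
  \<open>F\<close> absorbs the strands that enter and leave through the lower boundary. It is doubled so that the case
  \<open>F i = - rank i n\<close> compares the strands below with those above.
\<close>

locale labelled_strands = strands +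
  fixes F :: "int \<Rightarrow> int"
  assumes F_diff: "\<And>i. F i - F (i - 1) = - 2 * alt i * of_bool (u i 0)"
begin

definition height :: "int \<Rightarrow> nat \<Rightarrow> int" where
  "height i j = 2 * rank i j + F i"

text \<open>The height is read off in the gap containing the edge of \<open>M\<close> at the vertex.\<close>

definition label :: "int \<Rightarrow> nat \<Rightarrow> int" where
  "label i j = height (if even (i + int j) then i else i - 1) j"

lemma height_diff:
  "j \<le> n \<Longrightarrow> height i j - height (i - 1) j = - 2 * alt (i + int j) * of_bool (u i j)"
  using rank_diff[of j i] F_diff[of i] by (auto simp: height_def algebra_simps)

text \<open>If \<open>i + int j\<close> is odd, the crossing excludes vertical edges at the vertex,
  so both adjacent gaps give the same height.\<close>

lemma label_of_h: "j < n \<Longrightarrow> h i j \<Longrightarrow> label i j = height i j"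
  using odd_row[of j i] height_diff[of j i] by (auto simp: label_def)

text \<open>For even \<open>i + int j\<close> both ends read the same gap. Otherwise neither end has
  a vertical edge, and changing the gap does not change the height.\<close>

lemma label_horizontal:
  assumes "j < n" "h i j"
  shows "label i j = label (i + 1) j"
proof (cases "even (i + int j)")
  case False
  then have "\<not> u (i + 1) j" using even_row[of j "i + 1"] assms by simp
  then show ?thesis
    using label_of_h[OF assms] False assms height_diff[of j "i + 1"] by (simp add: label_def)
qed (simp add: label_def)

text \<open>The two ends have their edges of \<open>M\<close> in opposite gaps. Moving up past the
  edge of \<open>M\<close> raises the height by 2, and changing the gap in row \<open>Suc j\<close>
  lowers it by 2 again.\<close>

lemma label_vertical:
  assumes "Suc j < n" "u i (Suc j)"
  shows "label i j = label i (Suc j)"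
proof -
  have "height i (Suc j) = height i j + 2 * of_bool (h i j)"
    "height (i - 1) (Suc j) = height (i - 1) j + 2 * of_bool (h (i - 1) j)"
    by (simp_all add: height_def rank_Suc)
  then show ?thesis
    using assms even_row[of j i] odd_row[of j i] height_diff[of "Suc j" i]
    by (auto simp: label_def alt_def)
qed

end

section \<open>Matchings that do not extend\<close>

context torus
begin

lemma verts_T_eq: "verts T = {..<p} \<times> {..<q}"
  by (simp add: cart_prod_def cycle_graph_def verts_def)

text \<open>The edges of \<open>M\<close> partition the vertices into pairs.\<close>

lemma perfect_matching_even:
  assumes "perfect_matching T M"
  shows "even (p * q)"
proof -
  have M: "M \<subseteq> edges T" "\<And>v. v \<in> verts T \<Longrightarrow> \<exists>!e. e \<in> M \<and> v \<in> e"
    using assms by (auto simp: perfect_matching_def)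
  have sub: "e \<subseteq> verts T" if "e \<in> M" for e using edge_T M(1) that by blast
  have U: "\<Union> M = verts T" using sub M(2) by blast
  have "2 dvd card (\<Union> M)"
  proof (rule dvd_partition)
    show "finite (\<Union> M)" unfolding U verts_T_eq by simp
    show "\<forall>e\<in>M. 2 dvd card e" using edge_T M(1) by auto
    show "\<forall>c1\<in>M. \<forall>c2\<in>M. c1 \<noteq> c2 \<longrightarrow> c1 \<inter> c2 = {}" using M(2) sub by blast
  qed
  then show ?thesis unfolding U verts_T_eq by simp
qed

text \<open>As \<open>N\<close> avoids the edge of \<open>M\<close> at a band vertex, its degree
  equation selects exactly one of three edges: the opposite horizontal one or one of the two
  vertical ones.\<close>

lemma strands_of_matchings:
  assumes N: "perfect_matching T N" and MN: "M \<inter> N = {}"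
    and M: "\<And>i j. 0 \<le> j \<Longrightarrow> j < int n \<Longrightarrow> hedge i j \<in> M \<longleftrightarrow> even (i + j)"
  shows "strands n (\<lambda>i j. hedge i (int j) \<in> M \<union> N) (\<lambda>i j. vedge i (int j - 1) \<in> N)"
proof -
  have *: "of_bool (hedge i (int j) \<in> N) + of_bool (hedge (i - 1) (int j) \<in> N)
         + of_bool (vedge i (int j) \<in> N) + of_bool (vedge i (int j - 1) \<in> N) = (1::int)" for i j
    using N unfolding perfect_matching_iff by blast
  show ?thesis
  proof
    fix i j assume j: "j < n" and e: "even (i + int j)"
    then have "hedge i (int j) \<in> M" "hedge (i - 1) (int j) \<notin> M" using M by auto
    moreover from this have "hedge i (int j) \<notin> N" using MN by auto
    ultimately show "hedge i (int j) \<in> M \<union> N \<and> (hedge (i - 1) (int j) \<in> M \<union> N \<longleftrightarrow>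
      \<not> vedge i (int j - 1) \<in> N \<and> \<not> vedge i (int (Suc j) - 1) \<in> N)"
      using *[of i j] by (auto simp: of_bool_def split: if_splits)
  next
    fix i j assume j: "j < n" and e: "odd (i + int j)"
    then have "hedge i (int j) \<notin> M" "hedge (i - 1) (int j) \<in> M" using M by auto
    moreover from this have "hedge (i - 1) (int j) \<notin> N" using MN by auto
    ultimately show "hedge (i - 1) (int j) \<in> M \<union> N \<and> (hedge i (int j) \<in> M \<union> N \<longleftrightarrow>
      \<not> vedge i (int j - 1) \<in> N \<and> \<not> vedge i (int (Suc j) - 1) \<in> N)"
      using *[of i j] by (auto simp: of_bool_def split: if_splits)
  next
    fix i j assume j: "j < n"
    show "\<not> (vedge i (int j - 1) \<in> N \<and> vedge i (int (Suc j) - 1) \<in> N)"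
      using *[of i j] by (auto simp: of_bool_def split: if_splits)
  qed
qed

lemma even_mod_p: "even p \<Longrightarrow> even (i mod int p) \<longleftrightarrow> even i" for i :: int
  by (metis dvd_mod_iff even_of_nat)

lemma mod_eq_evenD: "even p \<Longrightarrow> i mod int p = a mod int p \<Longrightarrow> even i \<longleftrightarrow> even a" for i a :: int
  using even_mod_p[of i] even_mod_p[of a] by simp

text \<open>An edge has many integer indices, so \<open>P\<close> can be read off from an edge only
  if it respects congruence of indices.\<close>

lemma hedge_mem:
  assumes "\<And>a b. i mod int p = a mod int p \<Longrightarrow> j mod int q = b mod int q \<Longrightarrow> P a b = P i j"
  shows "hedge i j \<in> {hedge i j | i j. P i j} \<longleftrightarrow> P i j"
  using assms hedge_eq by blast

lemma vedge_mem:
  assumes "\<And>a b. i mod int p = a mod int p \<Longrightarrow> j mod int q = b mod int q \<Longrightarrow> P a b = P i j"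
  shows "vedge i j \<in> {vedge i j | i j. P i j} \<longleftrightarrow> P i j"
  using assms vedge_eq by blast

lemma perfect_matching_exists:
  assumes "even p"
  shows "\<exists>M. perfect_matching T M"
proof
  let ?M = "{hedge i j | i j. even i}"
  have "hedge i j \<in> ?M \<longleftrightarrow> even i" for i j
    by (rule hedge_mem) (metis mod_eq_evenD assms)
  moreover have "vedge i j \<notin> ?M" for i j using hedge_neq_vedge by blast
  ultimately show "perfect_matching T ?M"
    unfolding perfect_matching_iff by (auto simp: edges_T)
qed

text \<open>Comparing the two lowest strands forces exactly two strands in every gap. Then no edge
  of \<open>N\<close> crosses the seam, and the label separates the two strands.\<close>

lemma not_PMH_odd:
  assumes p: "even p" and q: "odd q"
  shows "\<not> PMH_property T"
proof
  assume PMH: "PMH_property T"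
  \<comment> \<open>Reducing \<open>j\<close> before testing parity gives rows \<open>q - 1\<close>
    and \<open>0\<close> the same shift, since \<open>q - 1\<close> is even; the seam lies between
    them.\<close>
  define M where "M = {hedge i j | i j. even (i + j mod int q)}"
  have Mh: "hedge i j \<in> M \<longleftrightarrow> even (i + j mod int q)" for i j
    unfolding M_def
  proof (rule hedge_mem)
    fix a b assume "i mod int p = a mod int p" "j mod int q = b mod int q"
    then show "even (a + b mod int q) = even (i + j mod int q)"
      using mod_eq_evenD[OF p, of i a] by simp
  qed
  have Mv: "vedge i j \<notin> M" for i j
    unfolding M_def using hedge_neq_vedge by auto
  have M: "perfect_matching T M"
    unfolding perfect_matching_iff Mh using Mv by (auto simp: M_def edges_T)
  obtain N where N: "perfect_matching T N" and H: "hamiltonian_cycle T (M \<union> N)"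
    using PMH M unfolding PMH_property_def by blast
  have MN: "M \<inter> N = {}"
    using hamiltonian_union_disjoint[OF H M N edge_T] .
  define h where "h = (\<lambda>i j. hedge i (int j) \<in> M \<union> N)"
  define u where "u = (\<lambda>i j. vedge i (int j - 1) \<in> N)"
  interpret strands q h u
    unfolding h_def u_def by (rule strands_of_matchings[OF N MN]) (simp add: Mh)
  have u_wrap: "u i q = u i 0" for i
    using vedge_wrap(2)[of i "-1"] by (simp add: u_def algebra_simps)
  define W where "W i = rank i q" for i
  \<comment> \<open>As \<open>q\<close> is odd, \<open>alt (i + int q) = - alt i\<close>: the two
    boundary terms add up instead of cancelling.\<close>
  have W_diff: "W i - W (i - 1) = 2 * alt i * of_bool (u i 0)" for i
    using rank_diff[of q i] q by (auto simp: W_def u_wrap alt_def)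
  define F where "F i = - W i" for i
  interpret labelled_strands q h u F
  proof
    show "F i - F (i - 1) = - 2 * alt i * of_bool (u i 0)" for i
      using W_diff[of i] unfolding F_def by linarith
  qed
  have per: "label (i + int p) j = label i j" for i j
  proof -
    have "h (i + int p) j = h i j" for i j by (simp add: h_def hedge_wrap)
    then have "rank (i + int p) j = rank i j" for i j by (simp add: rank_def)
    then have "height (i + int p) j = height i j" for i j by (simp add: height_def F_def W_def)
    from this[of "i - 1"] this[of i] show ?thesis using p by (simp add: label_def algebra_simps)
  qed
  \<comment> \<open>\<open>label i j + 1\<close> is the number of strands below minus the number of strands above\<close>
  have seam: "label i (q - 1) + 1 = - (label i 0 + 1)" if "u i 0" for i
  proof -
    have q0: "0 < q" using q3 by simp
    have R: "W k = rank k (q - 1) + of_bool (h k (q - 1))" for k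
      using rank_Suc[of k "q - 1"] q0 by (simp add: W_def)
    have "h (if even i then i else i - 1) (q - 1)"
      using even_row[of "q - 1" i] odd_row[of "q - 1" i] q0 q by (auto simp: of_nat_diff)
    then show ?thesis using R[of i] R[of "i - 1"] q q0
      by (auto simp: label_def height_def F_def of_nat_diff)
  qed
  have abs_const: "\<bar>label i j + 1\<bar> = \<bar>label a b + 1\<bar>" if "j < q" "b < q" for i a j b
  proof -
    have "\<bar>label i (nat (int j mod int q)) + 1\<bar> = \<bar>label a (nat (int b mod int q)) + 1\<bar>"
    proof (rule hamiltonian_const[OF H, where f = "\<lambda>i j. \<bar>label i (nat (j mod int q)) + 1\<bar>"])
      fix i j :: int assume j: "0 \<le> j" "j < int q"
      show "\<bar>label i (nat (j mod int q)) + 1\<bar> = \<bar>label (i + 1) (nat (j mod int q)) + 1\<bar>" if "hedge i j \<in> M \<union> N"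
        using that j label_horizontal[of "nat j" i] by (simp add: h_def nat_less_iff)
      show "\<bar>label i (nat (j mod int q)) + 1\<bar> = \<bar>label i (nat ((j + 1) mod int q)) + 1\<bar>" if "vedge i j \<in> M \<union> N"
      proof (cases "j + 1 = int q")
        case True
        then have "u i 0" using that Mv u_wrap[of i] j by (simp add: u_def flip: True)
        moreover have "nat j = q - 1" using True by auto
        ultimately show ?thesis using seam[of i] True j by simp
      next
        case False
        then have "u i (Suc (nat j))" "Suc (nat j) < q" using that Mv j by (auto simp: u_def)
        then show ?thesis using label_vertical[of "nat j" i] False j by (simp add: nat_add_distrib)
      qed
    qed (simp_all add: per)
    then show ?thesis using that by simp
  qed
  \<comment> \<open>In an even column the two lowest strands have \<open>label + 1\<close> equal to
    \<open>1 - W i\<close> and \<open>3 - W i\<close>; since \<open>W i \<ge> 2\<close>, equal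
    absolute values leave only \<open>W i = 2\<close>. The second strand is met in row 1 or row 2,
    depending on \<open>h i 1\<close>.\<close>
  have W2: "W i = 2" if i: "even i" for i
  proof -
    have h: "h i 0" "h i 2" using even_row[of 0 i] even_row[of 2 i] i q3 by auto
    have r: "rank i 1 = 1" "rank i 2 = 1 + of_bool (h i 1)" "rank i 3 = rank i 2 + 1"
      using h by (simp_all add: rank_Suc numeral_2_eq_2 numeral_3_eq_3)
    have W: "W i \<ge> rank i 3" unfolding W_def using q3 by (intro rank_mono)
    have l0: "label i 0 = - W i" using i by (simp add: label_def height_def F_def)
    show ?thesis
    proof (cases "h i 1")
      case True
      then have "label i 1 = 2 - W i" using label_of_h[of 1 i] q3 r by (simp add: height_def F_def)
      then show ?thesis using abs_const[of 0 1 i i] q3 W r True l0 by auto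
    next
      case False
      then have "label i 2 = 2 - W i" using i r by (simp add: label_def height_def F_def)
      then show ?thesis using abs_const[of 0 2 i i] q3 l0 by auto
    qed
  qed
  \<comment> \<open>A seam edge in an odd column would lower the count from 2 to 0, but row 1
    carries a strand there.\<close>
  have u_odd: "\<not> u i 0 \<and> W i = 2" if i: "odd i" for i
  proof -
    have "h i 1" using even_row[of 1 i] i q3 by simp
    then have "rank i 2 \<ge> 1" by (simp add: rank_Suc numeral_2_eq_2)
    moreover have "W i \<ge> rank i 2" unfolding W_def using q3 by (intro rank_mono) simp
    ultimately show ?thesis using W_diff[of i] W2[of "i - 1"] i by (cases "u i 0") (auto simp: alt_def)
  qed
  have no_seam: "\<not> u i 0" for i
    using u_odd[of i] u_odd[of "i - 1"] W2[of i] W_diff[of i] by (cases "even i") (auto simp: alt_def)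
  \<comment> \<open>Without seam edges the signed label itself is invariant, yet it differs between
    rows \<open>0\<close> and \<open>2\<close> of column \<open>0\<close>.\<close>
  have "label 0 (nat (0 mod int q)) = label 0 (nat (2 mod int q))"
  proof (rule hamiltonian_const[OF H, where f = "\<lambda>i j. label i (nat (j mod int q))"])
    fix i j :: int assume j: "0 \<le> j" "j < int q"
    show "label i (nat (j mod int q)) = label (i + 1) (nat (j mod int q))" if "hedge i j \<in> M \<union> N"
      using that j label_horizontal[of "nat j" i] by (simp add: h_def nat_less_iff)
    show "label i (nat (j mod int q)) = label i (nat ((j + 1) mod int q))" if "vedge i j \<in> M \<union> N"
    proof (cases "j + 1 = int q")
      case True
      then have "u i 0" using that Mv u_wrap[of i] j by (simp add: u_def flip: True)
      then show ?thesis using no_seam by simp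
    next
      case False
      then have "u i (Suc (nat j))" "Suc (nat j) < q" using that Mv j by (auto simp: u_def)
      then show ?thesis using label_vertical[of "nat j" i] False j by (simp add: nat_add_distrib)
    qed
  qed (simp_all add: per)
  then have "label 0 0 = label 0 2" using q3 by simp
  moreover have "rank 0 2 \<ge> 1"
    using even_row[of 0 0] q3 rank_mono[of 1 2 0] by (simp add: rank_Suc)
  ultimately show False by (simp add: label_def height_def F_def)
qed

text \<open>Strands leave the band only with label 0 at the bottom or \<open>S 0 - 2\<close> at the
  top, so label 2 is trapped once \<open>S 0\<close> is at least 6. The remaining value 4 allows no
  edge across the boundary at all.\<close>

lemma not_PMH_even:
  assumes p: "even p" and q: "even q" and q6: "q \<ge> 6"
  shows "\<not> PMH_property T"
proof
  assume PMH: "PMH_property T"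
  define n where "n = q - 2"
  have n: "int q = int n + 2" "even n" "n \<ge> 4" "n < q" using q q6 by (auto simp: n_def)
  define M where "M = {hedge i j | i j. even (i + j mod int q) \<and> j mod int q < int n} \<union>
    {vedge i j | i j. j mod int q = int n}"
  have Mh: "hedge i j \<in> M \<longleftrightarrow> even (i + j mod int q) \<and> j mod int q < int n" for i j
  proof -
    have "hedge i j \<in> {hedge i j | i j. even (i + j mod int q) \<and> j mod int q < int n} \<longleftrightarrow>
      even (i + j mod int q) \<and> j mod int q < int n"
    proof (rule hedge_mem)
      fix a b assume "i mod int p = a mod int p" "j mod int q = b mod int q"
      then show "(even (a + b mod int q) \<and> b mod int q < int n) =
          (even (i + j mod int q) \<and> j mod int q < int n)"
        using mod_eq_evenD[OF p, of i a] by simp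
    qed
    then show ?thesis unfolding M_def using hedge_neq_vedge by blast
  qed
  have Mv: "vedge i j \<in> M \<longleftrightarrow> j mod int q = int n" for i j
  proof -
    have "vedge i j \<in> {vedge i j | i j. j mod int q = int n} \<longleftrightarrow> j mod int q = int n"
      by (rule vedge_mem) simp
    then show ?thesis unfolding M_def using hedge_neq_vedge by blast
  qed
  have M: "perfect_matching T M"
    unfolding perfect_matching_iff
  proof (intro conjI allI)
    show "M \<subseteq> edges T" by (auto simp: M_def edges_T)
    fix i j :: int
    define k where "k = j mod int q"
    have k: "0 \<le> k" "k < int n + 2" using n(1) by (auto simp: k_def)
    have "(j - 1) mod int q = (k - 1) mod int q" by (simp add: k_def mod_diff_left_eq)
    moreover have "(k - 1) mod int q = int n \<longleftrightarrow> k = int n + 1"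
    proof (cases "k = 0")
      case True
      have "(-1) mod int q = int n + 1" using n(1) by (simp add: zmod_minus1)
      then show ?thesis using True by simp
    qed (use k n(1) in auto)
    ultimately show "of_bool (hedge i j \<in> M) + of_bool (hedge (i - 1) j \<in> M)
         + of_bool (vedge i j \<in> M) + of_bool (vedge i (j - 1) \<in> M) = (1::int)"
      using k unfolding Mh Mv k_def[symmetric] by (auto simp: of_bool_def)
  qed
  obtain N where N: "perfect_matching T N" and H: "hamiltonian_cycle T (M \<union> N)"
    using PMH M unfolding PMH_property_def by blast
  have MN: "M \<inter> N = {}"
    using hamiltonian_union_disjoint[OF H M N edge_T] .
  define h where "h = (\<lambda>i j. hedge i (int j) \<in> M \<union> N)"
  define u where "u = (\<lambda>i j. vedge i (int j - 1) \<in> N)"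
  define a where "a = (\<lambda>i. hedge i (int n) \<in> N)"
  define b where "b = (\<lambda>i. hedge i (int n + 1) \<in> N)"
  interpret strands n h u
    unfolding h_def u_def using n by (intro strands_of_matchings[OF N MN]) (auto simp: Mh)
  have deg: "of_bool (hedge i j \<in> N) + of_bool (hedge (i - 1) j \<in> N)
         + of_bool (vedge i j \<in> N) + of_bool (vedge i (j - 1) \<in> N) = (1::int)" for i j
    using N unfolding perfect_matching_iff by blast
  \<comment> \<open>The edges between the two extra rows belong to \<open>M\<close>, so
    \<open>N\<close> covers a vertex there horizontally or by an edge across the boundary of the
    band.\<close>
  have "vedge i (int n) \<notin> N" for i
    using Mv[of i "int n"] MN n by auto
  then have a: "of_bool (a i) + of_bool (a (i - 1)) + of_bool (u i n) = (1::int)"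
    and b: "of_bool (b i) + of_bool (b (i - 1)) + of_bool (u i 0) = (1::int)" for i
    using deg[of i "int n"] deg[of i "int n + 1"] vedge_wrap(2)[of i "-1"] n(1)
    by (auto simp: a_def b_def u_def algebra_simps)
  \<comment> \<open>Along row \<open>n + 1\<close> the values of \<open>b\<close> alternate except
    at a boundary edge, where \<open>b\<close> is false on both sides. So
    \<open>odd i \<noteq> b i\<close> changes exactly there, in the direction given by the parity of
    \<open>i\<close>. \<open>F'\<close> does the same for row \<open>n\<close> with the opposite
    sign.\<close>
  define F :: "int \<Rightarrow> int" where "F i = 2 * of_bool (odd i \<noteq> b i)" for i
  define F' :: "int \<Rightarrow> int" where "F' i = 2 * of_bool (even i \<noteq> a i)" for i
  have F_diff: "F i - F (i - 1) = - 2 * alt i * of_bool (u i 0)" for i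
    using b[of i] by (auto simp: F_def alt_def of_bool_def split: if_splits)
  have F'_diff: "F' i - F' (i - 1) = 2 * alt i * of_bool (u i n)" for i
    using a[of i] by (auto simp: F'_def alt_def of_bool_def split: if_splits)
  interpret labelled_strands n h u F
    by unfold_locales (rule F_diff)
  have per: "label (i + int p) j = label i j" for i j
  proof -
    have "h (i + int p) j = h i j" "F (i + int p) = F i" for i j
      using p by (simp_all add: h_def F_def b_def hedge_wrap)
    then have "height (i + int p) j = height i j" for i j by (simp add: height_def rank_def)
    from this[of "i - 1"] this[of i] show ?thesis using p by (simp add: label_def algebra_simps)
  qed
  define S where "S i = 2 * rank i n + F i + F' i" for i
  \<comment> \<open>\<open>S\<close> is twice the number of strands in a gap, corrected at both boundaries\<close>
  have S_step: "S i = S (i - 1)" for i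
    using rank_diff[of n i] F_diff[of i] F'_diff[of i] n by (simp add: S_def alt_def split: if_splits)
  have S_const: "S i = S 0" for i
  proof (induction i rule: int_induct[where k = 0])
    case (step1 i)
    then show ?case using S_step[of "i + 1"] by simp
  next
    case (step2 i)
    then show ?case using S_step[of i] by simp
  qed simp
  \<comment> \<open>Two of the rows \<open>0\<close> to \<open>3\<close> have even
    \<open>i + j\<close> and thus an edge of \<open>M\<close> in the gap; \<open>q \<ge> 6\<close>
    provides these four rows.\<close>
  have rank2: "rank i n \<ge> 2" for i
  proof -
    have "rank i 4 \<ge> 2"
      using even_row[of 0 i] even_row[of 1 i] even_row[of 2 i] even_row[of 3 i] n(3)
      by (cases "even i") (auto simp: rank_Suc eval_nat_numeral)
    then show ?thesis using rank_mono[OF n(3), of i] by simp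
  qed
  have F_range: "F i = 0 \<or> F i = 2" "F' i = 0 \<or> F' i = 2" for i by (auto simp: F_def F'_def)
  have vertical_cases:
    "(j + 1 < int n \<and> u i (Suc (nat j))) \<or> (j = int n - 1 \<and> u i n) \<or> j = int n \<or> (j = int n + 1 \<and> u i 0)"
    if j: "0 \<le> j" "j < int q" "vedge i j \<in> M \<union> N" for i j
  proof -
    have inN: "vedge i j \<in> N" if "j \<noteq> int n" using that j Mv[of i j] by simp
    have wrap: "vedge i (int n + 1) = vedge i (-1)"
      using vedge_wrap(2)[of i "-1"] n(1) by (simp add: algebra_simps)
    consider "j + 1 < int n" | "j = int n - 1" | "j = int n" | "j = int n + 1"
      using j n(1) by linarith
    then show ?thesis
    proof cases
      case 1
      then have "u i (Suc (nat j))" using inN j by (simp add: u_def)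
      then show ?thesis using 1 by simp
    next
      case 2
      then have "u i n" using inN by (simp add: u_def)
      then show ?thesis using 2 by simp
    next
      case 4
      then have "u i 0" using inN wrap by (simp add: u_def)
      then show ?thesis using 4 by simp
    qed simp
  qed
  show False
  proof (cases "S 0 = 4")
    \<comment> \<open>As \<open>rank\<close> is at least 2, both corrections vanish in every gap.
      Hence nothing crosses the boundary, and membership in the band is invariant.\<close>
    case True
    have F0: "F i = 0" "F' i = 0" for i
    proof -
      have "2 * rank i n + F i + F' i = 4" using S_const[of i] True unfolding S_def by linarith
      moreover have "F i \<ge> 0" "F' i \<ge> 0" using F_range[of i] by linarith+
      ultimately show "F i = 0" "F' i = 0" using rank2[of i] by linarith+
    qed
    have nu: "\<not> u i 0 \<and> \<not> u i n" for i
      using F_diff[of i] F'_diff[of i] unfolding F0 by (auto simp: alt_def split: if_splits)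
    have "(0 mod int q < int n) = (int n mod int q < int n)"
    proof (rule hamiltonian_const[OF H, where f = "\<lambda>i j. j mod int q < int n"])
      fix i j :: int assume j: "0 \<le> j" "j < int q" "vedge i j \<in> M \<union> N"
      show "(j mod int q < int n) = ((j + 1) mod int q < int n)"
        using vertical_cases[OF j] nu[of i] j n(1) by auto
    qed simp_all
    then show False using n by simp
  next
    case False
    have S6: "2 * rank i n + F i + F' i \<ge> 6" for i
    proof -
      have "2 * rank i n + F i + F' i \<noteq> 4" using S_const[of i] False unfolding S_def by linarith
      moreover have "even (F i)" "even (F' i)" "F i \<ge> 0" "F' i \<ge> 0" using F_range[of i] by auto
      ultimately show ?thesis using rank2[of i] by presburger
    qed
    \<comment> \<open>At a boundary edge \<open>F\<close> jumps so that it is 0 in the gap read by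
      the label; the label is therefore 0.\<close>
    have bot: "label i 0 \<noteq> 2" if "u i 0" for i
      using that F_diff[of i] F_range[of i] F_range[of "i - 1"]
      by (auto simp: label_def height_def alt_def split: if_splits)
    \<comment> \<open>Likewise \<open>F'\<close> is 0 in the gap read here, and the topmost strand
      has label \<open>S 0 - 2\<close>, which is at least 4.\<close>
    have top: "label i (n - 1) \<noteq> 2" if "u i n" for i
    proof -
      have n1: "int (n - 1) = int n - 1" "n - 1 < n" "Suc (n - 1) = n" using n(3) by auto
      have r: "rank i' n = rank i' (n - 1) + of_bool (h i' (n - 1))" for i'
        using rank_Suc[of i' "n - 1"] n1 by simp
      show ?thesis
      proof (cases "even i")
        case True
        then have "h (i - 1) (n - 1)" using odd_row[OF n1(2), of i] n1 n(2) by simp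
        moreover have "F' (i - 1) = 0"
          using F'_diff[of i] F_range(2)[of i] F_range(2)[of "i - 1"] that True by (auto simp: alt_def)
        ultimately show ?thesis
          using S6[of "i - 1"] r[of "i - 1"] True n1 n(2) by (simp add: label_def height_def)
      next
        case False
        then have "h i (n - 1)" using even_row[OF n1(2), of i] n1 n(2) by simp
        moreover have "F' i = 0"
          using F'_diff[of i] F_range(2)[of i] F_range(2)[of "i - 1"] that False by (auto simp: alt_def)
        ultimately show ?thesis
          using S6[of i] r[of i] False n1 n(2) by (simp add: label_def height_def)
      qed
    qed
    define P where "P i j \<longleftrightarrow> j mod int q < int n \<and> label i (nat (j mod int q)) = 2" for i j
    \<comment> \<open>If \<open>F 0 = 2\<close>, row \<open>0\<close> has label 2. Otherwise the
      second lowest strand has it, found in row 1 or row 2.\<close>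
    obtain k where k: "k < n" "label 0 k = 2"
    proof (cases "F 0 = 0")
      case True
      have h0: "rank 0 1 = 1" using even_row[of 0 0] n(3) by (simp add: rank_Suc)
      show ?thesis
      proof (cases "h 0 1")
        case True
        then show ?thesis using that[of 1] label_of_h[of 1 0] h0 n(3) \<open>F 0 = 0\<close> by (simp add: height_def)
      next
        case False
        then have "rank 0 2 = 1" using h0 rank_Suc[of 0 1] by (simp add: numeral_2_eq_2)
        then show ?thesis using that[of 2] n(3) True by (simp add: label_def height_def)
      qed
    next
      case False
      then show ?thesis using that[of 0] F_range(1)[of 0] n(3) by (simp add: label_def height_def)
    qed
    have "P 0 (int k) = P 0 (int n)"
    proof (rule hamiltonian_const[OF H, where f = P])
      fix i j :: int assume j: "0 \<le> j" "j < int q"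
      show "P i j = P (i + 1) j" if "hedge i j \<in> M \<union> N"
        using that j label_horizontal[of "nat j" i] by (auto simp: P_def h_def nat_less_iff)
      show "P i j = P i (j + 1)" if "vedge i j \<in> M \<union> N"
        using vertical_cases[OF j that]
      proof (elim disjE conjE)
        assume "j + 1 < int n" "u i (Suc (nat j))"
        then show ?thesis
          using label_vertical[of "nat j" i] j n(1) by (simp add: P_def nat_add_distrib)
      next
        assume "j = int n - 1" "u i n"
        moreover from this have "nat j = n - 1" by simp
        ultimately show ?thesis using top[of i] j n(1) by (simp add: P_def)
      next
        assume "j = int n"
        then show ?thesis using n(1) by (simp add: P_def)
      next
        assume "j = int n + 1" "u i 0"
        moreover from this n(1) have "j mod int q = j" "j + 1 = int q" by auto
        ultimately show ?thesis using bot[of i] by (simp add: P_def)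
      qed
    qed (simp_all add: P_def per)
    then show False using k n by (simp add: P_def)
  qed
qed

end

section \<open>The case \<open>p = q = 4\<close>\<close>

text \<open>
  \<open>close_up E s c [] es\<close> searches for a path that starts in \<open>c\<close>, alternates between \<open>E\<close> and all the edges \<open>es\<close>,
  and returns to \<open>s\<close>; \<open>close_ups E [] x [] ys\<close> performs this search for every perfect matching of \<open>x # ys\<close>.
  Conditionals replace the connectives, of which the simplifier would always evaluate both sides.
\<close>

function close_up :: "('a \<Rightarrow> 'a \<Rightarrow> bool) \<Rightarrow> 'a \<Rightarrow> 'a \<Rightarrow> ('a \<times> 'a) list \<Rightarrow> ('a \<times> 'a) list \<Rightarrow> bool" where
  "close_up E s c [] [] = E c s"
| "close_up E s c (e # sk) [] = False"
| "close_up E s c sk ((x, y) # es) =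
    (if (if E c x then close_up E s y [] (sk @ es) else False) then True
     else if (if E c y then close_up E s x [] (sk @ es) else False) then True
     else close_up E s c ((x, y) # sk) es)"
  by pat_completeness auto
termination
  by (relation "measures [\<lambda>(E, s, c, sk, es). length sk + length es, \<lambda>(E, s, c, sk, es). length es]") auto

function close_ups :: "('a \<Rightarrow> 'a \<Rightarrow> bool) \<Rightarrow> ('a \<times> 'a) list \<Rightarrow> 'a \<Rightarrow> 'a list \<Rightarrow> 'a list \<Rightarrow> bool" where
  "close_ups E acc x sk [] = True"
| "close_ups E acc x sk (y # ys) =
    (if (if E x y then (case sk @ ys of [] \<Rightarrow> close_up E x y [] acc
           | z # zs \<Rightarrow> close_ups E ((x, y) # acc) z [] zs) else True)
     then close_ups E acc x (sk @ [y]) ys else False)"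
  by pat_completeness auto
termination
  by (relation "measures [\<lambda>(E, acc, x, sk, ys). length sk + length ys, \<lambda>(E, acc, x, sk, ys). length ys]")
    (auto simp: append_eq_Cons_conv)

section \<open>Alternating cycles as lists of matched pairs\<close>

definition flat :: "('a \<times> 'a) list \<Rightarrow> 'a list" where
  "flat ps = concat (map (\<lambda>(x, y). [x, y]) ps)"

text \<open>Forgets the orientation, as the search may traverse a listed pair in either
  direction.\<close>

definition ends :: "'a \<times> 'a \<Rightarrow> 'a set" where
  "ends p = {fst p, snd p}"

lemma flat_simps [simp]:
  "flat [] = []" "flat ((x, y) # ps) = x # y # flat ps" "flat (ps @ qs) = flat ps @ flat qs"
  by (simp_all add: flat_def)

lemma ends_Pair [simp]: "ends (x, y) = {x, y}"
  by (simp add: ends_def)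

lemma length_flat: "length (flat ps) = 2 * length ps"
  by (induction ps) auto

lemma nth_flat:
  "i < length ps \<Longrightarrow> flat ps ! (2 * i) = fst (ps ! i) \<and> flat ps ! Suc (2 * i) = snd (ps ! i)"
  by (induction ps arbitrary: i) (auto simp: nth_Cons split: nat.splits)

lemma set_flat: "set (flat ps) = (\<Union>p\<in>set ps. ends p)"
  by (induction ps) auto

lemma set_flat_cong:
  assumes "ends ` set ps = ends ` set qs"
  shows "set (flat ps) = set (flat qs)"
proof -
  have "(\<Union>p\<in>set ps. ends p) = (\<Union>p\<in>set qs. ends p)" using assms by metis
  then show ?thesis by (simp only: set_flat)
qed

text \<open>The pairs are matching edges already, so \<open>E\<close> is demanded only for the links
  between them and for the closing link to \<open>s\<close>.\<close>

fun chain :: "('a \<Rightarrow> 'a \<Rightarrow> bool) \<Rightarrow> 'a \<Rightarrow> 'a \<Rightarrow> ('a \<times> 'a) list \<Rightarrow> bool" where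
  "chain E s c [] = E c s"
| "chain E s c ((x, y) # ps) = (E c x \<and> chain E s y ps)"

text \<open>Prepending a pair that ends in \<open>c\<close> makes the first link look like all
  others; \<open>d\<close> is arbitrary.\<close>

lemma chain_nth:
  "chain E s c ps \<Longrightarrow> i \<le> length ps \<Longrightarrow>
    E (snd (((d, c) # ps) ! i)) (if i = length ps then s else fst (ps ! i))"
proof (induction ps arbitrary: i c d)
  case (Cons p ps)
  obtain x y where p: "p = (x, y)" by (cases p)
  show ?case
  proof (cases i)
    case 0
    then show ?thesis using Cons.prems p by simp
  next
    case (Suc j)
    then show ?thesis using Cons.IH[of y j x] Cons.prems p by (cases "j = length ps") simp_all
  qed
qed simp

lemma close_up_sound:
  assumes "close_up E s c sk es" "distinct (flat (sk @ es))"
  shows "\<exists>ps. distinct (flat ps) \<and> ends ` set ps = ends ` set (sk @ es) \<and> chain E s c ps"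
  using assms
proof (induction E s c sk es rule: close_up.induct)
  case (3 E s c sk x y es)
  have d: "distinct (flat (sk @ es))" using "3.prems" by auto
  consider "E c x" "close_up E s y [] (sk @ es)" | "E c y" "close_up E s x [] (sk @ es)"
    | "\<not> (if E c x then close_up E s y [] (sk @ es) else False)"
      "\<not> (if E c y then close_up E s x [] (sk @ es) else False)"
      "close_up E s c ((x, y) # sk) es"
    using "3.prems"(1) by (auto split: if_splits)
  then show ?case
  proof cases
    case 1
    then obtain ps where ps: "distinct (flat ps)" "ends ` set ps = ends ` set (sk @ es)" "chain E s y ps"
      using "3.IH"(1) d by auto
    then show ?thesis using "3.prems"(2) set_flat_cong[OF ps(2)] 1 by (intro exI[of _ "(x, y) # ps"]) auto
  next
    case 2
    show ?thesis
    \<comment> \<open>The induction hypothesis for the reversed pair assumes that the forward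
      direction failed, so a forward success is treated separately.\<close>
    proof (cases "if E c x then close_up E s y [] (sk @ es) else False")
      case True
      then obtain ps where ps: "distinct (flat ps)" "ends ` set ps = ends ` set (sk @ es)" "chain E s y ps"
        using "3.IH"(1) d by (auto split: if_splits)
      then show ?thesis using "3.prems"(2) set_flat_cong[OF ps(2)] True
        by (intro exI[of _ "(x, y) # ps"]) (auto split: if_splits)
    next
      case False
      then obtain ps where ps: "distinct (flat ps)" "ends ` set ps = ends ` set (sk @ es)" "chain E s x ps"
        using "3.IH"(2)[OF False] 2 d by auto
      then show ?thesis using "3.prems"(2) set_flat_cong[OF ps(2)] 2 by (intro exI[of _ "(y, x) # ps"]) auto
    qed
  next
    case 3
    have "distinct (flat (((x, y) # sk) @ es))" using "3.prems"(2) by auto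
    then obtain ps where "distinct (flat ps)" "ends ` set ps = ends ` set (((x, y) # sk) @ es)" "chain E s c ps"
      using "3.IH"(3) 3 by blast
    then show ?thesis by (intro exI[of _ ps]) auto
  qed
next
  case (1 E s c)
  then show ?case by (intro exI[of _ "[]"]) simp
qed simp

text \<open>The edges at odd positions of the cyclic list serve as \<open>N\<close>: as the length
  is even, they pair up all vertices.\<close>

lemma alternating_cycle_extends:
  assumes vs: "distinct vs" "set vs = verts G" "even (length vs)" "length vs \<ge> 3"
    and M: "M = {{vs ! k, vs ! Suc k} | k. k < length vs \<and> even k}" "M \<subseteq> edges G"
    and odd_edge: "\<And>k. k < length vs \<Longrightarrow> odd k \<Longrightarrow> {vs ! k, vs ! (Suc k mod length vs)} \<in> edges G"
  shows "\<exists>N. perfect_matching G N \<and> hamiltonian_cycle G (M \<union> N)"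
proof -
  define n where "n = length vs"
  have n: "even n" "n \<ge> 3" using vs by (auto simp: n_def)
  have lt: "Suc k mod n < n" for k using n by simp
  have nth_eq: "vs ! i = vs ! j \<longleftrightarrow> i = j" if "i < n" "j < n" for i j
    using that vs(1) by (simp add: n_def nth_eq_iff_index_eq)
  define N where "N = {{vs ! k, vs ! (Suc k mod n)} | k. k < n \<and> odd k}"
  have par: "even (Suc k mod n) \<longleftrightarrow> odd k" for k
    using n(1) by (simp add: dvd_mod_iff)
  have "\<exists>!e. e \<in> N \<and> v \<in> e" if "v \<in> verts G" for v
  proof -
    have "v \<in> set vs" using that vs(2) by simp
    then obtain a where a: "a < n" "v = vs ! a" unfolding n_def in_set_conv_nth by blast
    \<comment> \<open>The odd position whose edge contains \<open>vs ! a\<close> is \<open>a\<close>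
      or its cyclic predecessor; for \<open>a = 0\<close> this is \<open>n - 1\<close>, which is
      odd.\<close>
    define k where "k = (if odd a then a else if a = 0 then n - 1 else a - 1)"
    have k: "k < n" "odd k" using a n by (auto simp: k_def)
    have eq: "(j = a \<or> Suc j mod n = a) \<longleftrightarrow> j = k" if j: "j < n" "odd j" for j
    proof (cases "Suc j = n")
      case True
      then show ?thesis using j a n by (auto simp: k_def)
    next
      case False
      then show ?thesis using j a n by (auto simp: k_def)
    qed
    have mem: "v \<in> {vs ! j, vs ! (Suc j mod n)} \<longleftrightarrow> j = k" if "j < n" "odd j" for j
      using eq[OF that] nth_eq[OF a(1) that(1)] nth_eq[OF a(1) lt[of j]] a(2) by auto
    show ?thesis
    proof
      show "{vs ! k, vs ! (Suc k mod n)} \<in> N \<and> v \<in> {vs ! k, vs ! (Suc k mod n)}"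
        using k mem[OF k] by (auto simp: N_def)
    next
      fix e assume "e \<in> N \<and> v \<in> e"
      then obtain j where "j < n" "odd j" "e = {vs ! j, vs ! (Suc j mod n)}" "v \<in> e"
        unfolding N_def by blast
      then show "e = {vs ! k, vs ! (Suc k mod n)}" using mem by blast
    qed
  qed
  moreover have N: "N \<subseteq> edges G" using odd_edge by (auto simp: N_def n_def)
  ultimately have "perfect_matching G N" by (simp add: perfect_matching_def)
  moreover have "M \<union> N = {{vs ! i, vs ! (Suc i mod length vs)} | i. i < length vs}"
  proof -
    have "Suc k mod n = Suc k" if "k < n" "even k" for k
      using that n by (metis Suc_lessI even_Suc mod_less)
    then have "M = {{vs ! k, vs ! (Suc k mod n)} | k. k < n \<and> even k}"
      unfolding M(1) n_def by (metis (no_types, lifting))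
    then show ?thesis unfolding N_def n_def by blast
  qed
  ultimately show ?thesis
    using vs M(2) N unfolding hamiltonian_cycle_def by blast
qed

text \<open>The enumeration tries every partner of \<open>x\<close>, so one branch follows
  \<open>M\<close>: there \<open>acc\<close> collects edges of \<open>M\<close>, and
  \<open>sk\<close> holds the vertices known not to be matched with \<open>x\<close>.\<close>

lemma close_ups_complete:
  assumes "close_ups E acc x sk ys"
    and "distinct (x # sk @ ys @ flat acc)" "set (x # sk @ ys @ flat acc) = V"
    and uniq: "\<And>v. v \<in> V \<Longrightarrow> \<exists>!e. e \<in> M \<and> v \<in> e"
    and edge: "\<And>e v. e \<in> M \<Longrightarrow> v \<in> e \<Longrightarrow> \<exists>w. e = {v, w} \<and> v \<in> V \<and> w \<in> V \<and> v \<noteq> w \<and> E v w"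
    and "{} \<notin> M"
    and "ends ` set acc \<subseteq> M" "\<forall>y\<in>set sk. {x, y} \<notin> M"
  shows "\<exists>a b es. close_up E a b [] es \<and> distinct (flat ((a, b) # es)) \<and>
    set (flat ((a, b) # es)) = V \<and> M = ends ` set ((a, b) # es)"
  using assms
proof (induction E acc x sk ys rule: close_ups.induct)
  \<comment> \<open>The partner of \<open>x\<close> is not in \<open>sk\<close>, so it would lie on
    an edge of \<open>acc\<close>. That edge is in \<open>M\<close> and would contain
    \<open>x\<close> as well, against distinctness.\<close>
  case (1 E acc x sk)
  obtain e where e: "e \<in> M" "x \<in> e" using "1.prems"(3,4) by fastforce
  obtain y where y: "e = {x, y}" "y \<in> V" "x \<noteq> y" using "1.prems"(5)[OF e] by blast
  then have "y \<in> set (flat acc)" using "1.prems"(3,8) e by auto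
  then obtain p where p: "p \<in> set acc" "y \<in> ends p" by (auto simp: set_flat)
  then have "ends p \<in> M" using "1.prems"(7) by blast
  then have "ends p = e" using "1.prems"(4)[OF y(2)] p(2) e y by blast
  then have "x \<in> set (flat acc)" using p e(2) by (auto simp: set_flat)
  then show ?case using "1.prems"(2) by simp
next
  case (2 E acc x sk y ys)
  show ?case
  proof (cases "{x, y} \<in> M")
    case True
    have "\<exists>w. {x, y} = {x, w} \<and> x \<in> V \<and> w \<in> V \<and> x \<noteq> w \<and> E x w"
      using "2.prems"(5)[OF True, of x] by simp
    then have E: "E x y" by (auto simp: doubleton_eq_iff)
    show ?thesis
    proof (cases "sk @ ys")
      case Nil
      then have c: "close_up E x y [] acc" using "2.prems"(1) E by (auto split: if_splits)
      have V: "set (flat ((x, y) # acc)) = V" using "2.prems"(3) Nil by auto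
      have "M \<subseteq> ends ` set ((x, y) # acc)"
      proof
        fix e assume e: "e \<in> M"
        then obtain v where v: "v \<in> e" using "2.prems"(6) by fastforce
        then have "v \<in> V" using "2.prems"(5)[OF e] by blast
        moreover from this obtain p where p: "p \<in> set ((x, y) # acc)" "v \<in> ends p"
          unfolding V[symmetric] set_flat by blast
        moreover have "ends p \<in> M" using p(1) True "2.prems"(7) by auto
        ultimately have "e = ends p" using "2.prems"(4)[of v] e v by blast
        then show "e \<in> ends ` set ((x, y) # acc)" using p(1) by blast
      qed
      moreover have "ends ` set ((x, y) # acc) \<subseteq> M" using True "2.prems"(7) by auto
      ultimately show ?thesis
        using c V "2.prems"(2) Nil by (intro exI[of _ x] exI[of _ y] exI[of _ acc]) auto
    next
      case (Cons z zs)
      show ?thesis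
      proof (rule "2.IH"(1)[OF E Cons])
        show "close_ups E ((x, y) # acc) z [] zs"
          using "2.prems"(1) E Cons by (auto split: if_splits)
        have d: "distinct (x # y # (sk @ ys) @ flat acc)" using "2.prems"(2) by auto
        show "distinct (z # [] @ zs @ flat ((x, y) # acc))"
          using d unfolding Cons by auto
        have "set (x # y # (sk @ ys) @ flat acc) = V" using "2.prems"(3) by auto
        then show "set (z # [] @ zs @ flat ((x, y) # acc)) = V"
          unfolding Cons by auto
      qed (use "2.prems" True in auto)
    qed
  next
    case False
    show ?thesis
    proof (rule "2.IH"(2))
      show *: "if E x y then (case sk @ ys of [] \<Rightarrow> close_up E x y [] acc
           | z # zs \<Rightarrow> close_ups E ((x, y) # acc) z [] zs) else True"
        and "close_ups E acc x (sk @ [y]) ys"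
        using "2.prems"(1) by (auto split: if_splits)
    qed (use "2.prems" False in auto)
  qed
qed

section \<open>Evaluation on the 4 by 4 torus\<close>

fun par :: "nat \<Rightarrow> bool" where "par 0 = False" | "par (Suc n) = (\<not> par n)"
fun adj4 :: "nat \<times> nat \<Rightarrow> nat \<times> nat \<Rightarrow> bool" where
  "adj4 (a, b) (c, d) = (if a = c then par b \<noteq> par d else if b = d then par a \<noteq> par c else False)"

lemma close_ups_4_4: "close_ups adj4 [] (0, 0) [] [(0, 1), (0, 2), (0, 3), (1, 0), (1, 1), (1, 2), (1, 3),
    (2, 0), (2, 1), (2, 2), (2, 3), (3, 0), (3, 1), (3, 2), (3, 3)]"
  by code_simp

lemma edges_cart_prod:
  "edges (cart_prod G H) =
    {{(u, v), (u, v')} | u v v'. u \<in> verts G \<and> {v, v'} \<in> edges H \<and> v \<noteq> v'} \<union>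
    {{(u, v), (u', v)} | u u' v. {u, u'} \<in> edges G \<and> u \<noteq> u' \<and> v \<in> verts H}"
  by (simp add: cart_prod_def edges_def[of "(_, _)"])

text \<open>The 4-cycle is the complete bipartite graph between its even and its odd
  vertices.\<close>

lemma cycle4_edge_iff:
  assumes "a < 4" "b < 4"
  shows "{a, b} \<in> edges (cycle_graph 4) \<and> a \<noteq> b \<longleftrightarrow> par a \<noteq> par b"
proof -
  have "{i::nat. i < 4} = {0, 1, 2, 3}" by auto
  then have "edges (cycle_graph 4) = {{0, 1}, {1, 2}, {2, 3}, {3, 0}}"
    by (simp add: cycle_graph_def edges_def setcompr_eq_image flip: numeral_2_eq_2)
  moreover have "a = 0 \<or> a = 1 \<or> a = 2 \<or> a = 3" "b = 0 \<or> b = 1 \<or> b = 2 \<or> b = 3"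
    using assms by auto
  ultimately show ?thesis
    by (elim disjE) (auto simp: doubleton_eq_iff eval_nat_numeral)
qed

lemma adj4_iff:
  assumes "x \<in> {..<4} \<times> {..<4}" "y \<in> {..<4} \<times> {..<4}"
  shows "{x, y} \<in> edges (cart_prod (cycle_graph 4) (cycle_graph 4)) \<longleftrightarrow> adj4 x y"
proof -
  obtain a b c d where xy: "x = (a, b)" "y = (c, d)" by (cases x, cases y)
  have lt: "a < 4" "b < 4" "c < 4" "d < 4" using assms xy by auto
  let ?C = "cycle_graph 4"
  have "{x, y} \<in> edges (cart_prod ?C ?C) \<longleftrightarrow>
      a = c \<and> {b, d} \<in> edges ?C \<and> b \<noteq> d \<or> b = d \<and> {a, c} \<in> edges ?C \<and> a \<noteq> c"
    (is "?L \<longleftrightarrow> ?R")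
  proof
    assume ?L
    then show ?R unfolding xy edges_cart_prod by (auto simp: doubleton_eq_iff insert_commute)
  next
    assume ?R
    moreover have "a \<in> verts ?C" "b \<in> verts ?C" using lt by (simp_all add: verts_def cycle_graph_def)
    ultimately show ?L unfolding xy edges_cart_prod by blast
  qed
  also have "\<dots> \<longleftrightarrow> adj4 x y"
    using cycle4_edge_iff[OF lt(1,3)] cycle4_edge_iff[OF lt(2,4)] by (auto simp: xy)
  finally show ?thesis .
qed

text \<open>Completeness of the enumeration lists \<open>M\<close> in a form for which
  \<open>close_up\<close> succeeded; soundness turns this into a cyclic vertex order alternating
  between \<open>M\<close> and other torus edges.\<close>

lemma PMH_4_4: "PMH_property (cart_prod (cycle_graph 4) (cycle_graph 4))"
proof -
  interpret torus 4 4 by unfold_locales auto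
  let ?V = "{..<4} \<times> {..<4} :: (nat \<times> nat) set"
  let ?rest = "[(0, 1), (0, 2), (0, 3), (1, 0), (1, 1), (1, 2), (1, 3),
    (2, 0), (2, 1), (2, 2), (2, 3), (3, 0), (3, 1), (3, 2), (3, 3)] :: (nat \<times> nat) list"
  have "\<exists>N. perfect_matching T N \<and> hamiltonian_cycle T (M \<union> N)" if M: "perfect_matching T M" for M
  proof -
    have sub: "M \<subseteq> edges T" using M by (simp add: perfect_matching_def)
    have "\<exists>a b es. close_up adj4 a b [] es \<and> distinct (flat ((a, b) # es)) \<and>
      set (flat ((a, b) # es)) = ?V \<and> M = ends ` set ((a, b) # es)"
    proof (rule close_ups_complete[OF close_ups_4_4])
      have "{..<4} = {0, 1, 2, 3 :: nat}" by auto
      then show "set ((0, 0) # [] @ ?rest @ flat []) = ?V" by auto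
      show "\<exists>!e. e \<in> M \<and> v \<in> e" if "v \<in> ?V" for v
        using M that unfolding perfect_matching_def verts_T_eq by blast
      show "\<exists>w. e = {v, w} \<and> v \<in> ?V \<and> w \<in> ?V \<and> v \<noteq> w \<and> adj4 v w" if e: "e \<in> M" "v \<in> e" for e v
      proof -
        have "card e = 2" "e \<subseteq> ?V" using e sub edge_T unfolding verts_T_eq[symmetric] by auto
        then obtain w where w: "e = {v, w}" "v \<noteq> w" using e(2) by (auto simp: card_2_iff)
        then have "adj4 v w" using \<open>e \<subseteq> ?V\<close> e(1) sub adj4_iff[of v w] by auto
        then show ?thesis using w \<open>e \<subseteq> ?V\<close> by blast
      qed
      show "{} \<notin> M" using sub edge_T by fastforce
    qed auto
    then obtain a b es where es: "close_up adj4 a b [] es" "distinct (flat ((a, b) # es))"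
      "set (flat ((a, b) # es)) = ?V" "M = ends ` set ((a, b) # es)" by blast
    obtain ps where ps: "distinct (flat ps)" "ends ` set ps = ends ` set es" "chain adj4 a b ps"
      using close_up_sound[OF es(1)] es(2) by auto
    \<comment> \<open>The search ran from \<open>b\<close> back to \<open>a\<close>, so the pair
      \<open>(a, b)\<close> opens the cycle.\<close>
    define qs where "qs = (a, b) # ps"
    define vs where "vs = flat qs"
    have vs: "distinct vs" "set vs = ?V" "M = ends ` set qs"
      using es ps set_flat_cong[OF ps(2)] by (auto simp: vs_def qs_def)
    have len: "length vs = 2 * length qs" by (simp add: vs_def length_flat)
    have "card ?V = 16" by simp
    then have "length vs = 16" using vs by (metis distinct_card)
    show ?thesis
    proof (rule alternating_cycle_extends)
      show "distinct vs" "set vs = verts T" "even (length vs)" "3 \<le> length vs" "M \<subseteq> edges T"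
        using vs sub \<open>length vs = 16\<close> by (simp_all add: verts_T_eq)
      show "M = {{vs ! k, vs ! Suc k} | k. k < length vs \<and> even k}"
      proof (intro set_eqI iffI)
        fix e assume "e \<in> M"
        then obtain i where "i < length qs" "e = ends (qs ! i)" unfolding vs(3) by (metis imageE in_set_conv_nth)
        then show "e \<in> {{vs ! k, vs ! Suc k} | k. k < length vs \<and> even k}"
          using nth_flat[of i qs] len unfolding vs_def[symmetric]
          by (intro CollectI exI[of _ "2 * i"]) (auto simp: ends_def)
      next
        fix e assume "e \<in> {{vs ! k, vs ! Suc k} | k. k < length vs \<and> even k}"
        then obtain k where k: "e = {vs ! k, vs ! Suc k}" "k < length vs" "even k" by blast
        then obtain i where "k = 2 * i" by (elim evenE)
        then have "i < length qs" "e = ends (qs ! i)"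
          using nth_flat[of i qs] len k unfolding vs_def[symmetric] by (auto simp: ends_def)
        then show "e \<in> M" unfolding vs(3) by simp
      qed
      fix k assume k: "k < length vs" "odd k"
      then obtain i where i: "k = Suc (2 * i)" by (metis oddE Suc_eq_plus1)
      have "i \<le> length ps" "i < length qs" using k len i by (auto simp: qs_def)
      have "adj4 (vs ! k) (vs ! (Suc k mod length vs))"
      proof (cases "i = length ps")
        \<comment> \<open>After the last pair the successor wraps to position 0, which holds the
          target \<open>a\<close>.\<close>
        case True
        then have "Suc k mod length vs = 2 * 0" using len i by (simp add: qs_def)
        then show ?thesis
          using chain_nth[OF ps(3) \<open>i \<le> length ps\<close>, of a] nth_flat[of i qs] nth_flat[of 0 qs] True
          unfolding vs_def[symmetric] by (simp add: i qs_def)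
      next
        case False
        then have "Suc k mod length vs = 2 * Suc i" using len i \<open>i \<le> length ps\<close> by (simp add: qs_def)
        then show ?thesis
          using chain_nth[OF ps(3) \<open>i \<le> length ps\<close>, of a] nth_flat[of i qs] nth_flat[of "Suc i" qs]
            False \<open>i \<le> length ps\<close>
          unfolding vs_def[symmetric] by (simp add: i qs_def)
      qed
      moreover have "vs ! k \<in> ?V"
        unfolding vs(2)[symmetric] using k(1) by simp
      moreover have "vs ! (Suc k mod length vs) \<in> ?V"
        unfolding vs(2)[symmetric] using \<open>length vs = 16\<close> by (intro nth_mem) simp
      ultimately show "{vs ! k, vs ! (Suc k mod length vs)} \<in> edges T"
        by (intro iffD2[OF adj4_iff])
    qed
  qed
  then show ?thesis using perfect_matching_exists unfolding PMH_property_def by auto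
qed

theorem mainTheorem2:
  fixes p q :: nat
  assumes "p \<ge> 3" and "q \<ge> 3"
  shows "PMH_property (cart_prod (cycle_graph p) (cycle_graph q)) \<longleftrightarrow> p = 4 \<and> q = 4"
proof
  assume PMH: "PMH_property (cart_prod (cycle_graph p) (cycle_graph q))"
  interpret pq: torus p q using assms by unfold_locales
  \<comment> \<open>The negative results ask for an even first length and are applied in both
    orders.\<close>
  interpret qp: torus q p using assms by unfold_locales
  note PMH' = PMH_property_swap[OF PMH]
  have "even (p * q)" using PMH pq.perfect_matching_even unfolding PMH_property_def by blast
  moreover have "\<not> (even p \<and> odd q)" "\<not> (even q \<and> odd p)"
    using PMH PMH' pq.not_PMH_odd qp.not_PMH_odd by blast+
  ultimately have even: "even p" "even q" by auto
  then have "p < 6" "q < 6"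
    using PMH PMH' pq.not_PMH_even qp.not_PMH_even by (meson not_le)+
  then show "p = 4 \<and> q = 4" using even assms by presburger
next
  assume "p = 4 \<and> q = 4"
  then show "PMH_property (cart_prod (cycle_graph p) (cycle_graph q))" using PMH_4_4 by simp
qed

end
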